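(* Consider a sequence of instances indexed by the number of items $n$, with threshold set $\mathcal B_n$. Assume there exist constants $\overline V<\infty$ and $c>0$, independent of $n$, such that for every instance in the sequence and every $\theta\in\mathcal B_n$, $$\Delta V_{\max}^\theta\le\overline V,\qquad \mathrm{OPT}_{\mathrm{LP},n}(\theta)\ge c\,n .$$ Then, uniformly over $\theta\in\mathcal B_n$, $$0\le\frac{\mathrm{OPT}_{\mathrm{LP},n}(\theta)-\mathrm{OPT}_{\mathrm{IP},n}(\theta)}{\mathrm{OPT}_{\mathrm{LP},n}(\theta)}\le\frac{\overline V}{c\,n}=O\!\left(\frac1n\right).$$
   Context: For each $n$, an instance consists of the following data. There are items $i=1,\dots,n$. Item $i$ has a finite price menu $\mathcal X_i=\{x_{i,1},\dots,x_{i,m}\}\subset\mathbb R$, a reference price $a_i>0$, an exposure $\omega_i>0$, a nominal demand function $\hat g_i:\mathcal X_i\to\mathbb R_{>0}$ (monotone decreasing on the admissible range), and a relative tolerance $\sigma_i$. A margin target $\Delta>0$ and an integer budget $\Gamma\in\{0,1,\dots,n\}$ are given. The admissible menu $\mathcal X_i^{\mathrm{ad}}=\mathcal X_i\cap[(1-\sigma_i)a_i,(1+\sigma_i)a_i]$ is assumed nonempty. A variability parameter $\delta_i(x_i)$ is given with $0\le\delta_i(x_i)<\hat g_i(x_i)$ on $\mathcal X_i^{\mathrm{ad}}$. All of these may vary with the instance. All option indices $j$ below range over admissible options of item $i$. Fixed-$\theta$ MCKP. Put $v_{ij}=\omega_i x_{i,j}\hat g_i(x_{i,j})$, $s_{ij}=\omega_i(x_{i,j}-\Delta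 a_i)\hat g_i(x_{i,j})$, $t_{ij}=\omega_i(x_{i,j}-\Delta a_i)\delta_i(x_{i,j})$. The threshold set of the instance is $\mathcal B_n=\{0\}\cup\{|t_{ij}|: x_{i,j}\in\mathcal X_i^{\mathrm{ad}}\}$. For $\theta\in\mathcal B_n$ let $s^\theta_{ij}=s_{ij}-\max\{0,|t_{ij}|-\theta\}$, choose $j^\theta(i)\in\arg\max_j s^\theta_{ij}$, and set $c^\theta_{ij}=s^\theta_{i,j^\theta(i)}-s^\theta_{ij}\ge0$ and $C^\theta=\sum_i s^\theta_{i,j^\theta(i)}-\Gamma\theta$. The fixed-$\theta$ MCKP is: choose one admissible option $j(i)$ per item to maximize $\sum_i v_{i,j(i)}$ subject to $\sum_i c^\theta_{i,j(i)}\le C^\theta$; its optimal value is $\mathrm{OPT}_{\mathrm{IP},n}(\theta)$. Its LP relaxation uses variables $z_{ij}\ge0$, $\sum_j z_{ij}=1$ for each $i$, with objective $\sum_{i,j}v_{ij}z_{ij}$ and constraint $\sum_{i,j}c^\theta_{ij}z_{ij}\le C^\theta$; its optimal value is $\mathrm{OPT}_{\mathrm{LP},n}(\theta)$. The optimal value of an infeasible problem is $-\infty$ (so the hypothesis $\mathrm{OPT}_{\mathrm{LP},n}(\theta)\ge cn$ includes feasibility of the LP). Upper hulls. Let $\mathcal P_i^\theta=\{(c^\theta_{ij},v_{ij})\}_j$. Discard dominated points ($(c',v')$ is discarded if another point $(c,v)$ has $c\le c'$, $v\ge v'$; for equal costs only the largest value is kept). Let $\{(c^{H,\theta}_{i,1},v^{H,\theta}_{i,1}),\dots,(c^{H,\theta}_{i,p_i},v^{H,\theta}_{i,p_i})\}$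 be the vertices of the resulting upper hull (efficient concave upper frontier), ordered by strictly increasing cost. Define $$\Delta V_{\max}^\theta=\max_i\max_{k=1,\dots,p_i-1}\big(v^{H,\theta}_{i,k+1}-v^{H,\theta}_{i,k}\big)\ge0,$$ with $\max_{k\in\emptyset}(\cdot)=0$ when $p_i=1$. *)

theory Defs
  imports "HOL-Analysis.Analysis" "HOL-Library.Landau_Symbols"
begin

record instance_data =
  num_items :: nat
  menu_size :: nat
  price :: "nat \<Rightarrow> nat \<Rightarrow> real"
  ref_price :: "nat \<Rightarrow> real"
  exposure :: "nat \<Rightarrow> real"
  demand :: "nat \<Rightarrow> real \<Rightarrow> real"
  tolerance :: "nat \<Rightarrow> real"
  margin_target :: real
  budget :: nat
  variability :: "nat \<Rightarrow> real \<Rightarrow> real"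

definition items :: "instance_data \<Rightarrow> nat set" where
  "items I = {1..num_items I}"

definition menu :: "instance_data \<Rightarrow> nat \<Rightarrow> real set" where
  "menu I i = price I i ` {1..menu_size I}"

definition adm_menu :: "instance_data \<Rightarrow> nat \<Rightarrow> real set" where
  "adm_menu I i = menu I i \<inter>
     {(1 - tolerance I i) * ref_price I i .. (1 + tolerance I i) * ref_price I i}"

definition adm_opts :: "instance_data \<Rightarrow> nat \<Rightarrow> nat set" where
  "adm_opts I i = {j \<in> {1..menu_size I}. price I i j \<in> adm_menu I i}"

definition valid_instance :: "instance_data \<Rightarrow> bool" where
  "valid_instance I \<longleftrightarrow>
     margin_target I > 0 \<and> budget I \<le> num_items I \<and>
     (\<forall>i\<in>items I.
        ref_price I i > 0 \<and> exposure I i > 0 \<and>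
        (\<forall>x\<in>menu I i. demand I i x > 0) \<and>
        monotone_on (adm_menu I i) (\<le>) (\<ge>) (demand I i) \<and>
        adm_menu I i \<noteq> {} \<and>
        (\<forall>x\<in>adm_menu I i. 0 \<le> variability I i x \<and> variability I i x < demand I i x))"

definition v_coef :: "instance_data \<Rightarrow> nat \<Rightarrow> nat \<Rightarrow> real" where
  "v_coef I i j = exposure I i * price I i j * demand I i (price I i j)"

definition s_coef :: "instance_data \<Rightarrow> nat \<Rightarrow> nat \<Rightarrow> real" where
  "s_coef I i j =
     exposure I i * (price I i j - margin_target I * ref_price I i) * demand I i (price I i j)"

definition t_coef :: "instance_data \<Rightarrow> nat \<Rightarrow> nat \<Rightarrow> real" where
  "t_coef I i j =
     exposure I i * (price I i j - margin_target I * ref_price I i) * variability I i (price I i j)"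

definition thresholds :: "instance_data \<Rightarrow> real set" where
  "thresholds I = {0} \<union> {\<bar>t_coef I i j\<bar> | i j. i \<in> items I \<and> j \<in> adm_opts I i}"

definition s_theta :: "instance_data \<Rightarrow> real \<Rightarrow> nat \<Rightarrow> nat \<Rightarrow> real" where
  "s_theta I \<theta> i j = s_coef I i j - max 0 (\<bar>t_coef I i j\<bar> - \<theta>)"

text \<open>Only the value of \<open>s_theta\<close> at the chosen maximiser is used below, so nothing depends on
  how ties are broken.\<close>

definition j_theta :: "instance_data \<Rightarrow> real \<Rightarrow> nat \<Rightarrow> nat" where
  "j_theta I \<theta> i = arg_max_on (s_theta I \<theta> i) (adm_opts I i)"

definition c_theta :: "instance_data \<Rightarrow> real \<Rightarrow> nat \<Rightarrow> nat \<Rightarrow> real" where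
  "c_theta I \<theta> i j = s_theta I \<theta> i (j_theta I \<theta> i) - s_theta I \<theta> i j"

definition C_theta :: "instance_data \<Rightarrow> real \<Rightarrow> real" where
  "C_theta I \<theta> = (\<Sum>i\<in>items I. s_theta I \<theta> i (j_theta I \<theta> i)) - real (budget I) * \<theta>"

definition IP_feasible :: "instance_data \<Rightarrow> real \<Rightarrow> (nat \<Rightarrow> nat) set" where
  "IP_feasible I \<theta> =
     {f. (\<forall>i\<in>items I. f i \<in> adm_opts I i) \<and> (\<Sum>i\<in>items I. c_theta I \<theta> i (f i)) \<le> C_theta I \<theta>}"

definition LP_feasible :: "instance_data \<Rightarrow> real \<Rightarrow> (nat \<Rightarrow> nat \<Rightarrow> real) set" where
  "LP_feasible I \<theta> =
     {z. (\<forall>i\<in>items I. (\<forall>j\<in>adm_opts I i. z i j \<ge> 0) \<and> (\<Sum>j\<in>adm_opts I i. z i j) = 1) \<and>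
         (\<Sum>i\<in>items I. \<Sum>j\<in>adm_opts I i. c_theta I \<theta> i j * z i j) \<le> C_theta I \<theta>}"

text \<open>The optimal values are extended reals, so that an infeasible problem has value
  \<open>Sup {} = - \<infinity>\<close>.\<close>

definition OPT_IP :: "instance_data \<Rightarrow> real \<Rightarrow> ereal" where
  "OPT_IP I \<theta> = (SUP f\<in>IP_feasible I \<theta>. ereal (\<Sum>i\<in>items I. v_coef I i (f i)))"

definition OPT_LP :: "instance_data \<Rightarrow> real \<Rightarrow> ereal" where
  "OPT_LP I \<theta> =
     (SUP z\<in>LP_feasible I \<theta>. ereal (\<Sum>i\<in>items I. \<Sum>j\<in>adm_opts I i. v_coef I i j * z i j))"

definition points :: "instance_data \<Rightarrow> real \<Rightarrow> nat \<Rightarrow> (real \<times> real) set" where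
  "points I \<theta> i = (\<lambda>j. (c_theta I \<theta> i j, v_coef I i j)) ` adm_opts I i"

definition undominated :: "(real \<times> real) set \<Rightarrow> (real \<times> real) set" where
  "undominated P = {p \<in> P. \<not> (\<exists>q\<in>P. q \<noteq> p \<and> fst q \<le> fst p \<and> snd q \<ge> snd p)}"

text \<open>The vertices of the upper hull are the extreme points of the convex hull that lie on its
  upper boundary.\<close>

definition upper_hull_vertices :: "(real \<times> real) set \<Rightarrow> (real \<times> real) set" where
  "upper_hull_vertices E =
     {p. p extreme_point_of (convex hull E) \<and> (\<forall>y. (fst p, y) \<in> convex hull E \<longrightarrow> y \<le> snd p)}"

definition hull_list :: "instance_data \<Rightarrow> real \<Rightarrow> nat \<Rightarrow> (real \<times> real) list" where
  "hull_list I \<theta> i = sorted_key_list_of_set fst (upper_hull_vertices (undominated (points I \<theta> i)))"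

definition hull_increments :: "instance_data \<Rightarrow> real \<Rightarrow> nat \<Rightarrow> real set" where
  "hull_increments I \<theta> i =
     {snd (hull_list I \<theta> i ! Suc k) - snd (hull_list I \<theta> i ! k) | k.
        Suc k < length (hull_list I \<theta> i)}"

definition DeltaV_max :: "instance_data \<Rightarrow> real \<Rightarrow> real" where
  "DeltaV_max I \<theta> =
     Max ((\<lambda>i. if hull_increments I \<theta> i = {} then 0 else Max (hull_increments I \<theta> i)) ` items I)"

lemma finite_adm_opts: "finite (adm_opts I i)"
  by (simp add: adm_opts_def)

lemma j_theta_maximal:
  assumes "valid_instance I" "i \<in> items I"
  shows "j_theta I \<theta> i \<in> adm_opts I i"
    and "j \<in> adm_opts I i \<Longrightarrow> s_theta I \<theta> i j \<le> s_theta I \<theta> i (j_theta I \<theta> i)"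
proof -
  let ?A = "adm_opts I i" and ?f = "s_theta I \<theta> i"
  have "?A \<noteq> {}"
    using assms by (force simp: valid_instance_def adm_opts_def adm_menu_def menu_def)
  then have "Max (?f ` ?A) \<in> ?f ` ?A" by (simp add: finite_adm_opts)
  then obtain k where k: "k \<in> ?A" "?f k = Max (?f ` ?A)" by auto
  have "is_arg_max ?f (\<lambda>x. x \<in> ?A) k"
    using k by (auto simp: is_arg_max_linorder finite_adm_opts)
  then have "is_arg_max ?f (\<lambda>x. x \<in> ?A) (j_theta I \<theta> i)"
    unfolding j_theta_def arg_max_on_def arg_max_def by (rule someI)
  then show "j_theta I \<theta> i \<in> ?A" and "j \<in> ?A \<Longrightarrow> ?f j \<le> ?f (j_theta I \<theta> i)"
    by (auto simp: is_arg_max_linorder)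
qed

lemma hull_list_props:
  fixes I \<theta> i
  defines "H \<equiv> upper_hull_vertices (undominated (points I \<theta> i))"
  shows "set (hull_list I \<theta> i) = H"
    and "sorted_wrt (<) (map fst (hull_list I \<theta> i))"
proof -
  have inj: "inj_on fst H"
  proof (rule inj_onI)
    fix p q assume pq: "p \<in> H" "q \<in> H" "fst p = fst q"
    then have "p \<in> convex hull undominated (points I \<theta> i)" "q \<in> convex hull undominated (points I \<theta> i)"
      by (auto simp: H_def upper_hull_vertices_def extreme_point_of_def)
    then have "(fst p, snd q) \<in> convex hull undominated (points I \<theta> i)"
      "(fst q, snd p) \<in> convex hull undominated (points I \<theta> i)"
      using pq(3) by (metis prod.collapse)+
    then have "snd q \<le> snd p" "snd p \<le> snd q"
      using pq by (auto simp: H_def upper_hull_vertices_def)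
    then show "p = q" using pq(3) by (simp add: prod_eq_iff)
  qed
  have "H \<subseteq> points I \<theta> i"
    by (auto simp: H_def upper_hull_vertices_def undominated_def dest!: extreme_point_of_convex_hull)
  then have fin: "finite H"
    using finite_subset finite_adm_opts by (fastforce simp: points_def)
  interpret folding_insort_key "(\<le>)" "(<)" H "fst :: real \<times> real \<Rightarrow> real"
    rewrites "linorder.sorted_key_list_of_set (\<le>) (fst :: real \<times> real \<Rightarrow> real) =
                sorted_key_list_of_set fst"
  proof -
    have lin: "class.linorder ((\<le>) :: real \<Rightarrow> real \<Rightarrow> bool) (<)" by unfold_locales
    have ins: "linorder.insort_key (\<le>) (fst :: real \<times> real \<Rightarrow> real) = insort_key fst"
    proof (intro ext)
      fix x :: "real \<times> real" and xs
      show "linorder.insort_key (\<le>) fst x xs = insort_key fst x xs"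
        by (induction xs) (simp_all add: linorder.insort_key.simps[OF lin])
    qed
    show "folding_insort_key (\<le>) (<) H (fst :: real \<times> real \<Rightarrow> real)"
      using inj by unfold_locales
    show "linorder.sorted_key_list_of_set (\<le>) (fst :: real \<times> real \<Rightarrow> real) =
        sorted_key_list_of_set fst"
      by (simp add: linorder.sorted_key_list_of_set_def[OF lin] sorted_key_list_of_set_def ins)
  qed
  show "set (hull_list I \<theta> i) = H"
    unfolding hull_list_def H_def[symmetric] using fin by simp
  show "sorted_wrt (<) (map fst (hull_list I \<theta> i))"
    unfolding hull_list_def H_def[symmetric] using strict_sorted_key_list_of_set[of H] by simp
qed

end

theory Submission
  imports Defs
begin

text \<open>
  The gap between the two optimal values is at most one hull increment, whatever the number of
  items, whereas the LP value grows linearly in that number. The bound on the gap comes from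
  Lagrangian duality.

  For a multiplier \<open>\<mu> \<ge> 0\<close> call an assignment optimal if it maximises \<open>v - \<mu> c\<close> for every item
  separately. Such an assignment \<open>h\<close> bounds every LP value from above by its own value plus
  \<open>\<mu>\<close> times its unused capacity, so if it is feasible, then the gap is at most \<open>\<mu>\<close> times the
  slack of \<open>h\<close> (\<open>lagrangian_bound\<close>). At a critical multiplier there are two optimal assignments,
  one of total cost at most the capacity and one of total cost at least the capacity
  (\<open>critical_multiplier\<close>). Switching items one after the other from the cheap to the expensive
  assignment, one passes the capacity at a single item \<open>k\<close>, and the slack just before this switch
  is at most the cost difference of the two options of \<open>k\<close> (\<open>single_exchange\<close>). All intermediate
  assignments remain optimal for \<open>\<mu>\<close>. Both options of \<open>k\<close> lie on the line of slope \<open>\<mu>\<close> that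
  supports the point set of \<open>k\<close> from above, and this line meets the upper hull in a single edge
  or vertex. Hence \<open>\<mu>\<close> times their cost difference is at most the increase in value along one
  edge of the hull (\<open>slope_face_le_DeltaV_max\<close>).
\<close>

section \<open>Lagrangian optimal assignments\<close>

definition lagrange_optimal ::
    "'i set \<Rightarrow> ('i \<Rightarrow> 'j set) \<Rightarrow> ('i \<Rightarrow> 'j \<Rightarrow> real) \<Rightarrow> ('i \<Rightarrow> 'j \<Rightarrow> real) \<Rightarrow> real \<Rightarrow> ('i \<Rightarrow> 'j) \<Rightarrow> bool"
  where
  "lagrange_optimal N Opt c v \<mu> f \<longleftrightarrow>
     (\<forall>i\<in>N. f i \<in> Opt i \<and> (\<forall>j\<in>Opt i. v i j - \<mu> * c i j \<le> v i (f i) - \<mu> * c i (f i)))"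

lemma lagrange_optimal_exists:
  assumes "\<And>i. i \<in> N \<Longrightarrow> finite (Opt i)" "\<And>i. i \<in> N \<Longrightarrow> Opt i \<noteq> {}"
  shows "\<exists>f\<in>PiE N Opt. lagrange_optimal N Opt c v \<mu> f"
proof -
  have "\<exists>j\<in>Opt i. \<forall>k\<in>Opt i. v i k - \<mu> * c i k \<le> v i j - \<mu> * c i j" if "i \<in> N" for i
  proof -
    let ?l = "\<lambda>j. v i j - \<mu> * c i j"
    have "Max (?l ` Opt i) \<in> ?l ` Opt i" using assms that by (intro Max_in) auto
    then obtain j where "j \<in> Opt i" "?l j = Max (?l ` Opt i)" by auto
    then show ?thesis using assms that by (metis (no_types, lifting) Max_ge finite_imageI imageI)
  qed
  then obtain f where "\<forall>i\<in>N. f i \<in> Opt i \<and> (\<forall>k\<in>Opt i. v i k - \<mu> * c i k \<le> v i (f i) - \<mu> * c i (f i))"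
    by metis
  then show ?thesis
    by (intro bexI[of _ "restrict f N"]) (auto simp: lagrange_optimal_def)
qed

text \<open>Weak duality: the constraint of the LP is priced at \<open>\<mu>\<close>, after which the problem decomposes
  and a convex combination of the options of an item is no better than the best option.\<close>

lemma lagrangian_bound:
  fixes z :: "'i \<Rightarrow> 'j \<Rightarrow> real"
  assumes opt: "lagrange_optimal N Opt c v \<mu> h" and "\<mu> \<ge> 0"
    and nonneg: "\<And>i j. i \<in> N \<Longrightarrow> j \<in> Opt i \<Longrightarrow> z i j \<ge> 0"
    and unit: "\<And>i. i \<in> N \<Longrightarrow> (\<Sum>j\<in>Opt i. z i j) = 1"
    and cap: "(\<Sum>i\<in>N. \<Sum>j\<in>Opt i. c i j * z i j) \<le> C"
  shows "(\<Sum>i\<in>N. \<Sum>j\<in>Opt i. v i j * z i j)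
           \<le> (\<Sum>i\<in>N. v i (h i)) + \<mu> * (C - (\<Sum>i\<in>N. c i (h i)))"
proof -
  have item: "(\<Sum>j\<in>Opt i. v i j * z i j) - \<mu> * (\<Sum>j\<in>Opt i. c i j * z i j)
      \<le> v i (h i) - \<mu> * c i (h i)" if i: "i \<in> N" for i
  proof -
    have "(\<Sum>j\<in>Opt i. v i j * z i j) - \<mu> * (\<Sum>j\<in>Opt i. c i j * z i j)
        = (\<Sum>j\<in>Opt i. (v i j - \<mu> * c i j) * z i j)"
      by (simp add: sum_distrib_left sum_subtractf[symmetric] algebra_simps)
    also have "\<dots> \<le> (\<Sum>j\<in>Opt i. (v i (h i) - \<mu> * c i (h i)) * z i j)"
      using opt i nonneg by (intro sum_mono mult_right_mono) (auto simp: lagrange_optimal_def)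
    also have "\<dots> = v i (h i) - \<mu> * c i (h i)"
      using unit[OF i] by (simp add: sum_distrib_left[symmetric])
    finally show ?thesis .
  qed
  have "(\<Sum>i\<in>N. \<Sum>j\<in>Opt i. v i j * z i j) - \<mu> * (\<Sum>i\<in>N. \<Sum>j\<in>Opt i. c i j * z i j)
      = (\<Sum>i\<in>N. (\<Sum>j\<in>Opt i. v i j * z i j) - \<mu> * (\<Sum>j\<in>Opt i. c i j * z i j))"
    by (simp add: sum_distrib_left[of \<mu> _ N] sum_subtractf)
  also have "\<dots> \<le> (\<Sum>i\<in>N. v i (h i) - \<mu> * c i (h i))"
    by (intro sum_mono item)
  also have "\<dots> = (\<Sum>i\<in>N. v i (h i)) - \<mu> * (\<Sum>i\<in>N. c i (h i))"
    by (simp add: sum_distrib_left sum_subtractf)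
  finally show ?thesis
    using mult_left_mono[OF cap \<open>\<mu> \<ge> 0\<close>] by (simp add: algebra_simps)
qed

lemma closed_lagrange_optimal: "closed {\<mu>. lagrange_optimal N Opt c v \<mu> f}"
proof -
  have "{\<mu>. lagrange_optimal N Opt c v \<mu> f} =
      (\<Inter>i\<in>N. {\<mu>. f i \<in> Opt i} \<inter>
        (\<Inter>j\<in>Opt i. {\<mu>. v i j - \<mu> * c i j \<le> v i (f i) - \<mu> * c i (f i)}))"
    by (auto simp: lagrange_optimal_def split: if_splits)
  also have "closed \<dots>"
    by (intro closed_INT ballI closed_Int closed_Collect_le closed_Collect_const continuous_intros)
  finally show ?thesis .
qed

text \<open>For a large multiplier cost dominates, so the best among the options of cost zero are optimal.\<close>

lemma lagrange_optimal_zero_cost: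
  assumes "finite N" "\<And>i. i \<in> N \<Longrightarrow> finite (Opt i)"
    and nonneg: "\<And>i j. i \<in> N \<Longrightarrow> j \<in> Opt i \<Longrightarrow> c i j \<ge> 0"
    and zero: "\<And>i. i \<in> N \<Longrightarrow> \<exists>j\<in>Opt i. c i j = 0"
  shows "\<exists>\<mu>\<ge>0. \<exists>f\<in>PiE N Opt. lagrange_optimal N Opt c v \<mu> f \<and> (\<Sum>i\<in>N. c i (f i)) = 0"
proof -
  let ?Z = "\<lambda>i. {j \<in> Opt i. c i j = 0}"
  have "\<exists>f\<in>PiE N ?Z. lagrange_optimal N ?Z c v 0 f"
    using assms(2) zero by (intro lagrange_optimal_exists) (simp, blast)
  then obtain f where f: "f \<in> PiE N ?Z" and best: "lagrange_optimal N ?Z c v 0 f" by blast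
  have "eventually (\<lambda>\<mu>. v i j - \<mu> * c i j \<le> v i (f i)) at_top" if "i \<in> N" "j \<in> Opt i" for i j
  proof (cases "c i j = 0")
    case True
    then show ?thesis using best that by (auto simp: lagrange_optimal_def)
  next
    case False
    then have "c i j > 0" using nonneg that by force
    then have "v i j - \<mu> * c i j \<le> v i (f i)" if "\<mu> \<ge> (v i j - v i (f i)) / c i j" for \<mu>
      using that by (simp add: field_simps)
    then show ?thesis by (auto simp: eventually_at_top_linorder)
  qed
  then have "eventually (\<lambda>\<mu>. \<forall>i\<in>N. \<forall>j\<in>Opt i. v i j - \<mu> * c i j \<le> v i (f i)) at_top"
    using assms by (intro eventually_ball_finite ballI) auto
  then obtain \<mu>0 where "\<forall>\<mu>\<ge>\<mu>0. \<forall>i\<in>N. \<forall>j\<in>Opt i. v i j - \<mu> * c i j \<le> v i (f i)"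
    by (auto simp: eventually_at_top_linorder)
  then have "lagrange_optimal N Opt c v (max 0 \<mu>0) f"
    using f by (auto simp: lagrange_optimal_def PiE_def Pi_def)
  moreover have "f \<in> PiE N Opt" "(\<Sum>i\<in>N. c i (f i)) = 0"
    using f by (auto simp: PiE_def Pi_def)
  ultimately show ?thesis by (intro exI[of _ "max 0 \<mu>0"]) auto
qed

text \<open>The multipliers that admit an optimal assignment within the capacity form a closed set, and so
  do those that admit one reaching the capacity, because there are only finitely many assignments.
  These two sets cover the half-line of multipliers. The half-line being connected, the sets meet
  unless the second one is empty, in which case even \<open>\<mu> = 0\<close> belongs to the first.\<close>

lemma critical_multiplier:
  fixes Opt :: "'i \<Rightarrow> 'j set"
  assumes fin: "finite N" "\<And>i. i \<in> N \<Longrightarrow> finite (Opt i)"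
    and nonneg: "\<And>i j. i \<in> N \<Longrightarrow> j \<in> Opt i \<Longrightarrow> c i j \<ge> 0"
    and zero: "\<And>i. i \<in> N \<Longrightarrow> \<exists>j\<in>Opt i. c i j = 0"
    and "C \<ge> 0"
  obtains \<mu> f g where "\<mu> \<ge> 0" "lagrange_optimal N Opt c v \<mu> f" "(\<Sum>i\<in>N. c i (f i)) \<le> C"
    "\<mu> = 0 \<or> lagrange_optimal N Opt c v \<mu> g \<and> C \<le> (\<Sum>i\<in>N. c i (g i))"
proof -
  let ?L = "\<lambda>f. {\<mu>. lagrange_optimal N Opt c v \<mu> f}"
  define A where "A = (\<Union>f\<in>{f \<in> PiE N Opt. (\<Sum>i\<in>N. c i (f i)) \<le> C}. ?L f)"
  define B where "B = (\<Union>f\<in>{f \<in> PiE N Opt. C \<le> (\<Sum>i\<in>N. c i (f i))}. ?L f)"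
  have "finite {f \<in> PiE N Opt. Q f}" for Q
    using fin by (simp add: finite_PiE)
  then have closed: "closed A" "closed B"
    unfolding A_def B_def by (simp_all add: closed_UN closed_lagrange_optimal)
  have cover: "\<mu> \<in> A \<union> B" for \<mu>
  proof -
    obtain f where "f \<in> PiE N Opt" "lagrange_optimal N Opt c v \<mu> f"
      using lagrange_optimal_exists[of N Opt c v \<mu>] fin zero by blast
    then show ?thesis by (cases "(\<Sum>i\<in>N. c i (f i)) \<le> C") (auto simp: A_def B_def)
  qed
  obtain \<mu>0 f0 where "\<mu>0 \<ge> 0" "f0 \<in> PiE N Opt" "lagrange_optimal N Opt c v \<mu>0 f0"
    "(\<Sum>i\<in>N. c i (f0 i)) = 0"
    using lagrange_optimal_zero_cost[of N Opt c v, OF fin nonneg zero] by blast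
  then have "\<mu>0 \<in> A \<inter> {0..}" using \<open>C \<ge> 0\<close> by (auto simp: A_def)
  then have "A \<inter> {0..} \<noteq> {}" by blast
  have "connected {0::real..}" by (intro convex_connected) simp
  then have "A \<inter> B \<inter> {0..} \<noteq> {} \<or> B \<inter> {0..} = {}"
    using closed cover \<open>A \<inter> {0..} \<noteq> {}\<close> unfolding connected_closed by blast
  then have "\<exists>\<mu>\<ge>0. \<mu> \<in> A \<and> (\<mu> = 0 \<or> \<mu> \<in> B)"
  proof
    assume "A \<inter> B \<inter> {0..} \<noteq> {}"
    then show ?thesis by auto
  next
    assume "B \<inter> {0..} = {}"
    then have "0 \<in> A" using cover[of 0] by auto
    then show ?thesis by auto
  qed
  then show thesis using that by (auto simp: A_def B_def)
qed

text \<open>Walking from \<open>f\<close> to \<open>g\<close> by changing one item at a time: \<open>h\<close> is the assignment just before the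
  switch of \<open>k\<close> makes the total cost reach \<open>C\<close>. The induction performs the switch of an item and
  charges it to the capacity unless it is this last one.\<close>

lemma single_exchange:
  fixes c :: "'i \<Rightarrow> 'j \<Rightarrow> real"
  assumes "finite N" "N \<noteq> {}" "(\<Sum>i\<in>N. c i (f i)) \<le> C" "C \<le> (\<Sum>i\<in>N. c i (g i))"
  shows "\<exists>h. \<exists>k\<in>N. (\<forall>i. h i = f i \<or> h i = g i) \<and> (\<Sum>i\<in>N. c i (h i)) \<le> C \<and>
           C - (\<Sum>i\<in>N. c i (h i)) \<le> c k (g k) - c k (f k)"
  using assms
proof (induction N arbitrary: C rule: finite_induct)
  case empty
  then show ?case by simp
next
  case (insert k N)
  show ?case
  proof (cases "C \<le> c k (g k) + (\<Sum>i\<in>N. c i (f i))")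
    case True
    then show ?thesis
      using insert by (intro exI[of _ f] bexI[of _ k]) auto
  next
    case False
    let ?C = "C - c k (g k)"
    have "(\<Sum>i\<in>N. c i (f i)) \<le> ?C" "?C \<le> (\<Sum>i\<in>N. c i (g i))" "N \<noteq> {}"
      using False insert by auto
    then obtain h l where h: "\<forall>i. h i = f i \<or> h i = g i" "(\<Sum>i\<in>N. c i (h i)) \<le> ?C"
      "l \<in> N" "?C - (\<Sum>i\<in>N. c i (h i)) \<le> c l (g l) - c l (f l)"
      using insert.IH[of ?C] by blast
    have "(\<Sum>i\<in>N. c i ((h(k := g k)) i)) = (\<Sum>i\<in>N. c i (h i))"
      using insert.hyps by (intro sum.cong) auto
    then show ?thesis
      using h insert.hyps by (intro exI[of _ "h(k := g k)"] bexI[of _ l]) auto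
  qed
qed

section \<open>Faces of the upper hull\<close>

definition slope_maximal :: "real \<Rightarrow> (real \<times> real) set \<Rightarrow> real \<times> real \<Rightarrow> bool" where
  "slope_maximal \<mu> P p \<longleftrightarrow> p \<in> P \<and> (\<forall>q\<in>P. snd q - \<mu> * fst q \<le> snd p - \<mu> * fst p)"

lemma slope_maximal_same_value:
  assumes "slope_maximal \<mu> P p" "slope_maximal \<mu> P q"
  shows "snd p - \<mu> * fst p = snd q - \<mu> * fst q"
  by (rule antisym) (use assms in \<open>unfold slope_maximal_def, blast\<close>)+

lemma slope_maximal_undominated:
  assumes "\<mu> > 0" "slope_maximal \<mu> P p"
  shows "p \<in> undominated P"
proof -
  have "q = p" if q: "q \<in> P" "fst q \<le> fst p" "snd q \<ge> snd p" for q
  proof -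
    have "snd q - \<mu> * fst q \<le> snd p - \<mu> * fst p"
      using assms q by (auto simp: slope_maximal_def)
    moreover have "\<mu> * fst q \<le> \<mu> * fst p" using assms q by simp
    ultimately have "snd q = snd p" "\<mu> * fst q = \<mu> * fst p" using q by linarith+
    then show ?thesis using assms by (simp add: prod_eq_iff)
  qed
  then show ?thesis using assms by (auto simp: undominated_def slope_maximal_def)
qed

lemma slope_bound_convex_hull:
  assumes "\<And>q. q \<in> E \<Longrightarrow> snd q - \<mu> * fst q \<le> m" "x \<in> convex hull E"
  shows "snd x - \<mu> * fst x \<le> (m::real)"
proof -
  have "convex {q :: real \<times> real. inner (-\<mu>, 1) q \<le> m}" by (rule convex_halfspace_le)
  moreover have "E \<subseteq> {q. inner (-\<mu>, 1) q \<le> m}"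
    using assms(1) by (force simp: inner_prod_def)
  ultimately have "convex hull E \<subseteq> {q. inner (-\<mu>, 1) q \<le> m}" by (rule hull_minimal[rotated])
  then show ?thesis using assms(2) by (auto simp: inner_prod_def)
qed

text \<open>The supporting line of slope \<open>\<mu>\<close> cuts out of the hull a face that is spanned by the points on
  that line. A point on it of extreme cost is therefore an end of this face. The sign of \<open>e\<close>
  selects the end: positive for the cheap one, negative for the expensive one.\<close>

lemma slope_face_end_is_vertex:
  assumes "\<mu> > 0" "finite P" and p: "slope_maximal \<mu> P p"
    and "e \<noteq> 0" and extremal: "\<And>q. slope_maximal \<mu> P q \<Longrightarrow> e * fst p \<le> e * fst q"
  shows "p \<in> upper_hull_vertices (undominated P)"
proof -
  let ?E = "undominated P" and ?m = "snd p - \<mu> * fst p"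
  have "?E \<subseteq> P" by (auto simp: undominated_def)
  then have "finite ?E" using \<open>finite P\<close> finite_subset by blast
  have bound: "snd x - \<mu> * fst x \<le> ?m" if "x \<in> convex hull ?E" for x
    by (rule slope_bound_convex_hull[OF _ that])
      (use p \<open>?E \<subseteq> P\<close> in \<open>auto simp: slope_maximal_def\<close>)
  let ?F = "convex hull ?E \<inter> {x. inner (-\<mu>, 1) x = ?m}"
  have "?F face_of convex hull ?E"
  proof (rule face_of_Int_supporting_hyperplane_le)
    show "inner (-\<mu>, 1) x \<le> ?m" if "x \<in> convex hull ?E" for x
      using bound[OF that] by (simp add: inner_prod_def)
  qed simp
  then obtain S where S: "S \<subseteq> ?E" "?F = convex hull S"
    using face_of_convex_hull_subset[OF finite_imp_compact[OF \<open>finite ?E\<close>]] by metis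
  have "slope_maximal \<mu> P s" if "s \<in> S" for s
  proof -
    have "s \<in> ?F" unfolding S(2) using that by (rule hull_inc)
    then have "snd s - \<mu> * fst s = ?m" by (simp add: inner_prod_def)
    moreover have "s \<in> P" using S(1) \<open>?E \<subseteq> P\<close> that by blast
    ultimately show ?thesis using p unfolding slope_maximal_def by metis
  qed
  then have "S \<subseteq> {x. inner (e, 0) x \<ge> e * fst p}"
    using extremal by (auto simp: inner_prod_def)
  then have "convex hull S \<subseteq> {x. inner (e, 0) x \<ge> e * fst p}"
    by (intro hull_minimal convex_halfspace_ge)
  then have F_side: "e * fst p \<le> e * fst x" if "x \<in> ?F" for x
    using that unfolding S(2) by (auto simp: inner_prod_def)
  have "p \<in> ?F"
    using slope_maximal_undominated[OF \<open>\<mu> > 0\<close> p] by (auto simp: inner_prod_def hull_inc)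
  have single: "?F \<inter> {x. inner (e, 0) x = e * fst p} = {p}"
  proof (intro subset_antisym subsetI)
    fix x assume "x \<in> ?F \<inter> {x. inner (e, 0) x = e * fst p}"
    then have "e * fst x = e * fst p" "snd x - \<mu> * fst x = ?m" by (simp_all add: inner_prod_def)
    then show "x \<in> {p}" using \<open>e \<noteq> 0\<close> by (simp add: prod_eq_iff)
  next
    show "x \<in> ?F \<inter> {x. inner (e, 0) x = e * fst p}" if "x \<in> {p}" for x
      using \<open>p \<in> ?F\<close> that by (simp add: inner_prod_def)
  qed
  have "convex ?F" by (intro convex_Int convex_convex_hull convex_hyperplane)
  then have "?F \<inter> {x. inner (e, 0) x = e * fst p} face_of ?F"
    by (rule face_of_Int_supporting_hyperplane_ge) (use F_side in \<open>simp add: inner_prod_def\<close>)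
  then have "{p} face_of convex hull ?E"
    unfolding single using \<open>?F face_of convex hull ?E\<close> by (rule face_of_trans)
  then have "p extreme_point_of convex hull ?E" by (simp add: face_of_singleton)
  moreover have "y \<le> snd p" if "(fst p, y) \<in> convex hull ?E" for y
    using bound[OF that] by simp
  ultimately show ?thesis by (auto simp: upper_hull_vertices_def)
qed

text \<open>A vertex whose cost lies strictly between would have to lie on the segment from \<open>p\<close> to \<open>q\<close>:
  not below it, since it is on the upper boundary, and not above it, since the segment is part
  of a supporting line. But an extreme point is not interior to a segment.\<close>

lemma no_vertex_between:
  assumes p: "slope_maximal \<mu> P p" "p \<in> undominated P" and q: "slope_maximal \<mu> P q" "q \<in> undominated P"
    and r: "r \<in> upper_hull_vertices (undominated P)" "fst p < fst r" "fst r < fst q"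
  shows False
proof -
  let ?E = "undominated P"
  define t where "t = (fst r - fst p) / (fst q - fst p)"
  have t: "0 < t" "t < 1" using r by (auto simp: t_def field_simps)
  define s where "s = (1 - t) *\<^sub>R p + t *\<^sub>R q"
  have eq: "snd q - \<mu> * fst q = snd p - \<mu> * fst p"
    using q(1) p(1) by (rule slope_maximal_same_value)
  have t_scale: "t * (fst q - fst p) = fst r - fst p" using r by (simp add: t_def)
  have fst_s: "fst s = fst r" using t_scale by (simp add: s_def algebra_simps)
  have "snd s - \<mu> * fst s = (1 - t) * (snd p - \<mu> * fst p) + t * (snd q - \<mu> * fst q)"
    by (simp add: s_def algebra_simps)
  also have "\<dots> = snd p - \<mu> * fst p" by (simp add: eq algebra_simps)
  finally have line: "snd s - \<mu> * fst s = snd p - \<mu> * fst p" .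
  have hull: "p \<in> convex hull ?E" "q \<in> convex hull ?E" using p q by (auto simp: hull_inc)
  then have "s \<in> convex hull ?E"
    unfolding s_def using t by (intro convexD convex_convex_hull) auto
  then have "(fst r, snd s) \<in> convex hull ?E" by (metis fst_s prod.collapse)
  then have "snd s \<le> snd r" using r(1) by (auto simp: upper_hull_vertices_def)
  moreover have "snd r - \<mu> * fst r \<le> snd p - \<mu> * fst p"
  proof (rule slope_bound_convex_hull)
    show "r \<in> convex hull ?E"
      using r(1) by (auto simp: upper_hull_vertices_def extreme_point_of_def)
    show "x \<in> ?E \<Longrightarrow> snd x - \<mu> * fst x \<le> snd p - \<mu> * fst p" for x
      using p(1) by (auto simp: slope_maximal_def undominated_def)
  qed
  ultimately have "r = s" using line fst_s by (simp add: prod_eq_iff)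
  moreover have "p \<noteq> q" using r by auto
  ultimately have "r \<in> open_segment p q"
    unfolding in_segment using t s_def by blast
  then show False
    using r(1) hull by (auto simp: upper_hull_vertices_def extreme_point_of_def)
qed

section \<open>Hull increments\<close>

lemma hull_list_fst_less:
  assumes "k < l" "l < length (hull_list I \<theta> i)"
  shows "fst (hull_list I \<theta> i ! k) < fst (hull_list I \<theta> i ! l)"
  using sorted_wrt_nth_less[OF hull_list_props(2)[of I \<theta> i], of k l] assms by simp

lemma finite_hull_increments: "finite (hull_increments I \<theta> i)"
proof -
  have "hull_increments I \<theta> i \<subseteq>
      (\<lambda>k. snd (hull_list I \<theta> i ! Suc k) - snd (hull_list I \<theta> i ! k)) ` {..<length (hull_list I \<theta> i)}"
    by (auto simp: hull_increments_def)
  then show ?thesis by (rule finite_subset) simp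
qed

lemma upper_hull_vertices_subset: "upper_hull_vertices E \<subseteq> E"
  by (auto simp: upper_hull_vertices_def dest: extreme_point_of_convex_hull)

lemma hull_increments_nonneg:
  assumes "d \<in> hull_increments I \<theta> i"
  shows "d \<ge> 0"
proof -
  let ?xs = "hull_list I \<theta> i"
  obtain k where k: "Suc k < length ?xs" "d = snd (?xs ! Suc k) - snd (?xs ! k)"
    using assms by (auto simp: hull_increments_def)
  have less: "fst (?xs ! k) < fst (?xs ! Suc k)"
    using hull_list_fst_less k(1) by blast
  have "?xs ! k \<in> undominated (points I \<theta> i)" "?xs ! Suc k \<in> undominated (points I \<theta> i)"
    using hull_list_props(1)[of I \<theta> i] upper_hull_vertices_subset k
    by (metis Suc_lessD nth_mem subsetD)+
  then have "\<not> snd (?xs ! Suc k) \<le> snd (?xs ! k)"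
    using less by (auto simp: undominated_def)
  then show ?thesis using k by simp
qed

lemma DeltaV_max_ge:
  assumes "i \<in> items I"
  shows "DeltaV_max I \<theta> \<ge> 0" and "d \<in> hull_increments I \<theta> i \<Longrightarrow> d \<le> DeltaV_max I \<theta>"
proof -
  let ?D = "\<lambda>i. if hull_increments I \<theta> i = {} then 0 else Max (hull_increments I \<theta> i)"
  have "finite (items I)" by (simp add: items_def)
  then have le: "?D i \<le> DeltaV_max I \<theta>"
    unfolding DeltaV_max_def using assms by (intro Max_ge) auto
  have "?D i \<ge> 0"
    using Max_in[OF finite_hull_increments[of I \<theta> i]] hull_increments_nonneg by auto
  with le show "DeltaV_max I \<theta> \<ge> 0" by linarith
  assume d: "d \<in> hull_increments I \<theta> i"
  then have "d \<le> ?D i" using finite_hull_increments by auto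
  with le show "d \<le> DeltaV_max I \<theta>" by linarith
qed

text \<open>Along the supporting line, \<open>\<mu>\<close> times a difference in cost is a difference in value, which is
  largest between the cheapest and the most expensive point. If these differ, they are vertices
  without a vertex in between, so they are neighbours in the list of vertices and their difference
  in value is an increment.\<close>

lemma slope_face_le_DeltaV_max:
  assumes "i \<in> items I" "\<mu> > 0"
    and p: "slope_maximal \<mu> (points I \<theta> i) p" and q: "slope_maximal \<mu> (points I \<theta> i) q"
  shows "\<mu> * (fst q - fst p) \<le> DeltaV_max I \<theta>"
proof -
  let ?P = "points I \<theta> i" and ?xs = "hull_list I \<theta> i"
  define M where "M = {r. slope_maximal \<mu> ?P r}"
  have "finite ?P" by (simp add: points_def finite_adm_opts)
  then have "finite M" by (rule finite_subset[rotated]) (auto simp: M_def slope_maximal_def)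
  moreover have "M \<noteq> {}" using p unfolding M_def by blast
  ultimately have "Min (fst ` M) \<in> fst ` M" "Max (fst ` M) \<in> fst ` M" by simp_all
  then obtain a b where a: "a \<in> M" "fst a = Min (fst ` M)" and b: "b \<in> M" "fst b = Max (fst ` M)"
    by auto
  have ends: "fst a \<le> fst r" "fst r \<le> fst b" if "slope_maximal \<mu> ?P r" for r
    using that a b \<open>finite M\<close> by (auto simp: M_def)
  have ab: "slope_maximal \<mu> ?P a" "slope_maximal \<mu> ?P b" using a b by (auto simp: M_def)
  have "\<mu> * (fst q - fst p) \<le> \<mu> * (fst b - fst a)"
    using ends(2)[OF q] ends(1)[OF p] \<open>\<mu> > 0\<close> by (intro mult_left_mono) auto
  also have "\<dots> = snd b - snd a"
    using slope_maximal_same_value[OF ab] by (simp add: algebra_simps)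
  finally have gap: "\<mu> * (fst q - fst p) \<le> snd b - snd a" .
  show ?thesis
  proof (cases "fst a = fst b")
    case True
    then have "fst p = fst q" using ends[OF p] ends[OF q] by linarith
    then show ?thesis using DeltaV_max_ge(1)[OF assms(1)] by simp
  next
    case False
    then have "fst a < fst b" using ends(1)[OF ab(2)] by simp
    have "a \<in> set ?xs" "b \<in> set ?xs"
      unfolding hull_list_props(1)
      using slope_face_end_is_vertex[OF \<open>\<mu> > 0\<close> \<open>finite ?P\<close> ab(1), of 1] ends
        slope_face_end_is_vertex[OF \<open>\<mu> > 0\<close> \<open>finite ?P\<close> ab(2), of "-1"] by auto
    then obtain k l where k: "k < length ?xs" "?xs ! k = a" and l: "l < length ?xs" "?xs ! l = b"
      by (auto simp: in_set_conv_nth)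
    have "k < l"
      using hull_list_fst_less[of l k I \<theta> i] k l \<open>fst a < fst b\<close> by (cases k l rule: linorder_cases) auto
    have "l = Suc k"
    proof (rule ccontr)
      assume "l \<noteq> Suc k"
      with \<open>k < l\<close> have "Suc k < l" by simp
      have "?xs ! Suc k \<in> upper_hull_vertices (undominated ?P)"
        using hull_list_props(1) \<open>Suc k < l\<close> l by (metis less_trans nth_mem)
      moreover have "fst a < fst (?xs ! Suc k)" "fst (?xs ! Suc k) < fst b"
        using hull_list_fst_less[of k "Suc k" I \<theta> i] hull_list_fst_less[of "Suc k" l I \<theta> i] \<open>Suc k < l\<close> k l
        by auto
      ultimately show False
        using no_vertex_between[OF ab(1) _ ab(2)] slope_maximal_undominated[OF \<open>\<mu> > 0\<close>] ab by blast
    qed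
    then have "snd b - snd a \<in> hull_increments I \<theta> i"
      using k l by (auto simp: hull_increments_def)
    then show ?thesis using gap DeltaV_max_ge(2)[OF assms(1)] by fastforce
  qed
qed

section \<open>The integrality gap\<close>

lemma finite_items: "finite (items I)"
  by (simp add: items_def)

lemma c_theta_nonneg:
  assumes "valid_instance I" "i \<in> items I" "j \<in> adm_opts I i"
  shows "c_theta I \<theta> i j \<ge> 0"
  using j_theta_maximal(2)[OF assms] by (simp add: c_theta_def)

text \<open>An integral assignment is the LP point given by its indicator function.\<close>

lemma OPT_IP_le_OPT_LP: "OPT_IP I \<theta> \<le> OPT_LP I \<theta>"
  unfolding OPT_IP_def
proof (rule SUP_least)
  fix f assume f: "f \<in> IP_feasible I \<theta>"
  define z :: "nat \<Rightarrow> nat \<Rightarrow> real" where "z i j = (if j = f i then 1 else 0)" for i j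
  have pick: "(\<Sum>j\<in>adm_opts I i. w j * z i j) = w (f i)" if "i \<in> items I" for i w
  proof -
    have "(\<Sum>j\<in>adm_opts I i. w j * z i j) = (\<Sum>j\<in>adm_opts I i. if j = f i then w j else 0)"
      by (intro sum.cong) (auto simp: z_def)
    then show ?thesis using f that by (simp add: finite_adm_opts IP_feasible_def)
  qed
  have "z \<in> LP_feasible I \<theta>"
    using f pick pick[of _ "\<lambda>_. 1"] by (auto simp: LP_feasible_def IP_feasible_def z_def)
  moreover have "(\<Sum>i\<in>items I. v_coef I i (f i)) =
      (\<Sum>i\<in>items I. \<Sum>j\<in>adm_opts I i. v_coef I i j * z i j)"
    using pick by simp
  ultimately show "ereal (\<Sum>i\<in>items I. v_coef I i (f i)) \<le> OPT_LP I \<theta>"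
    unfolding OPT_LP_def by (intro SUP_upper2[of z]) auto
qed

lemma C_theta_nonneg:
  assumes "valid_instance I" "z \<in> LP_feasible I \<theta>"
  shows "C_theta I \<theta> \<ge> 0"
proof -
  have "0 \<le> (\<Sum>i\<in>items I. \<Sum>j\<in>adm_opts I i. c_theta I \<theta> i j * z i j)"
    using assms by (intro sum_nonneg mult_nonneg_nonneg c_theta_nonneg) (auto simp: LP_feasible_def)
  then show ?thesis using assms(2) by (auto simp: LP_feasible_def)
qed

text \<open>Reference options have cost zero, so with nonnegative capacity a critical multiplier exists. If it
  is zero, then unused capacity costs nothing. Otherwise the assignment given by the exchange
  argument has slack at most one cost difference along a face of slope \<open>\<mu>\<close>.\<close>

lemma integrality_gap:
  assumes valid: "valid_instance I" and "num_items I \<ge> 1" and "C_theta I \<theta> \<ge> 0"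
  obtains h where "h \<in> IP_feasible I \<theta>"
    "OPT_LP I \<theta> \<le> ereal ((\<Sum>i\<in>items I. v_coef I i (h i)) + DeltaV_max I \<theta>)"
proof -
  let ?N = "items I" and ?c = "c_theta I \<theta>" and ?v = "v_coef I" and ?C = "C_theta I \<theta>"
  let ?opt = "lagrange_optimal ?N (adm_opts I) ?c ?v"
  have "?N \<noteq> {}" using assms(2) by (auto simp: items_def)
  have zero: "\<exists>j\<in>adm_opts I i. ?c i j = 0" if "i \<in> ?N" for i
    using j_theta_maximal(1)[OF valid that] by (auto simp: c_theta_def)
  obtain \<mu> f g where \<mu>: "\<mu> \<ge> 0" and f: "?opt \<mu> f" "(\<Sum>i\<in>?N. ?c i (f i)) \<le> ?C"
    and g: "\<mu> = 0 \<or> ?opt \<mu> g \<and> ?C \<le> (\<Sum>i\<in>?N. ?c i (g i))"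
    using critical_multiplier[of ?N "adm_opts I" ?c ?C ?v, OF finite_items finite_adm_opts
        c_theta_nonneg[OF valid] zero \<open>?C \<ge> 0\<close>] by blast
  have "\<exists>h. ?opt \<mu> h \<and> (\<Sum>i\<in>?N. ?c i (h i)) \<le> ?C \<and>
      \<mu> * (?C - (\<Sum>i\<in>?N. ?c i (h i))) \<le> DeltaV_max I \<theta>"
  proof (cases "\<mu> = 0")
    case True
    then show ?thesis using f \<open>?N \<noteq> {}\<close> DeltaV_max_ge(1) by auto
  next
    case False
    with g have g: "?opt \<mu> g" "?C \<le> (\<Sum>i\<in>?N. ?c i (g i))" by auto
    obtain h k where h: "\<forall>i. h i = f i \<or> h i = g i" "(\<Sum>i\<in>?N. ?c i (h i)) \<le> ?C"
      and k: "k \<in> ?N" "?C - (\<Sum>i\<in>?N. ?c i (h i)) \<le> ?c k (g k) - ?c k (f k)"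
      using single_exchange[of ?N ?c f ?C g, OF finite_items \<open>?N \<noteq> {}\<close> f(2) g(2)] by blast
    \<comment> \<open>Optimality is a condition on each item separately, so mixing \<open>f\<close> and \<open>g\<close> preserves it.\<close>
    have "?opt \<mu> h"
      unfolding lagrange_optimal_def using h(1) f(1) g(1) by (metis lagrange_optimal_def)
    have "slope_maximal \<mu> (points I \<theta> k) (?c k (h k), ?v k (h k))" if "?opt \<mu> h" for h
      using that k by (auto simp: slope_maximal_def points_def lagrange_optimal_def)
    from slope_face_le_DeltaV_max[OF k(1) _ this[OF f(1)] this[OF g(1)]]
    have "\<mu> * (?c k (g k) - ?c k (f k)) \<le> DeltaV_max I \<theta>" using \<mu> False by simp
    then show ?thesis
      using h(2) \<open>?opt \<mu> h\<close> mult_left_mono[OF k(2) \<mu>] by force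
  qed
  then obtain h where h: "?opt \<mu> h" "(\<Sum>i\<in>?N. ?c i (h i)) \<le> ?C"
    "\<mu> * (?C - (\<Sum>i\<in>?N. ?c i (h i))) \<le> DeltaV_max I \<theta>" by blast
  have "h \<in> IP_feasible I \<theta>"
    using h by (auto simp: IP_feasible_def lagrange_optimal_def)
  moreover have "(\<Sum>i\<in>?N. \<Sum>j\<in>adm_opts I i. ?v i j * z i j) \<le> (\<Sum>i\<in>?N. ?v i (h i)) + DeltaV_max I \<theta>"
    if "z \<in> LP_feasible I \<theta>" for z
    using lagrangian_bound[OF h(1) \<mu>, of z ?C] that h(3) by (force simp: LP_feasible_def)
  then have "OPT_LP I \<theta> \<le> ereal ((\<Sum>i\<in>?N. ?v i (h i)) + DeltaV_max I \<theta>)"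
    unfolding OPT_LP_def by (intro SUP_least) auto
  ultimately show thesis by (rule that)
qed

theorem corollary10:
  fixes I :: "nat \<Rightarrow> instance_data" and Vbar c :: real
  assumes "\<And>n. n \<ge> 1 \<Longrightarrow> valid_instance (I n)"
    and "\<And>n. n \<ge> 1 \<Longrightarrow> num_items (I n) = n"
    and "c > 0"
    and "\<And>n \<theta>. n \<ge> 1 \<Longrightarrow> \<theta> \<in> thresholds (I n) \<Longrightarrow> DeltaV_max (I n) \<theta> \<le> Vbar"
    and "\<And>n \<theta>. n \<ge> 1 \<Longrightarrow> \<theta> \<in> thresholds (I n) \<Longrightarrow> OPT_LP (I n) \<theta> \<ge> ereal (c * real n)"
  shows "(\<forall>n\<ge>1. \<forall>\<theta>\<in>thresholds (I n).
            0 \<le> (OPT_LP (I n) \<theta> - OPT_IP (I n) \<theta>) / OPT_LP (I n) \<theta> \<and>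
            (OPT_LP (I n) \<theta> - OPT_IP (I n) \<theta>) / OPT_LP (I n) \<theta> \<le> ereal (Vbar / (c * real n))) \<and>
         (\<lambda>n. Vbar / (c * real n)) \<in> O(\<lambda>n. 1 / real n)"
proof (intro conjI allI impI ballI)
  fix n \<theta> assume n: "n \<ge> (1::nat)" and \<theta>: "\<theta> \<in> thresholds (I n)"
  let ?J = "I n"
  \<comment> \<open>An infeasible LP would have value \<open>-\<infinity>\<close>.\<close>
  have "LP_feasible ?J \<theta> \<noteq> {}"
    using assms(5)[OF n \<theta>] by (auto simp: OPT_LP_def bot_ereal_def)
  then have "C_theta ?J \<theta> \<ge> 0" using C_theta_nonneg[OF assms(1)[OF n]] by blast
  then obtain h where h: "h \<in> IP_feasible ?J \<theta>"
    "OPT_LP ?J \<theta> \<le> ereal ((\<Sum>i\<in>items ?J. v_coef ?J i (h i)) + DeltaV_max ?J \<theta>)"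
    using integrality_gap[OF assms(1)[OF n]] assms(2)[OF n] n by metis
  let ?x = "\<Sum>i\<in>items ?J. v_coef ?J i (h i)"
  have x: "ereal ?x \<le> OPT_IP ?J \<theta>" unfolding OPT_IP_def by (rule SUP_upper[OF h(1)])
  have IL: "OPT_IP ?J \<theta> \<le> OPT_LP ?J \<theta>" by (rule OPT_IP_le_OPT_LP)
  have "OPT_LP ?J \<theta> \<noteq> \<infinity>" "OPT_IP ?J \<theta> \<noteq> \<infinity>" "OPT_LP ?J \<theta> \<noteq> -\<infinity>" "OPT_IP ?J \<theta> \<noteq> -\<infinity>"
    using h(2) x IL by auto
  then obtain L P where LP: "OPT_LP ?J \<theta> = ereal L" "OPT_IP ?J \<theta> = ereal P"
    by (metis ereal_cases)
  have "0 < c * real n" using assms(3) n by simp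
  moreover have "c * real n \<le> L" using assms(5)[OF n \<theta>] LP by simp
  moreover have "P \<le> L" "L - P \<le> Vbar" using IL x h(2) LP assms(4)[OF n \<theta>] by simp_all
  ultimately have "0 \<le> (L - P) / L" "(L - P) / L \<le> Vbar / (c * real n)" "L \<noteq> 0"
    by (auto intro!: frac_le)
  then show "0 \<le> (OPT_LP ?J \<theta> - OPT_IP ?J \<theta>) / OPT_LP ?J \<theta>"
    and "(OPT_LP ?J \<theta> - OPT_IP ?J \<theta>) / OPT_LP ?J \<theta> \<le> ereal (Vbar / (c * real n))"
    unfolding LP by simp_all
next
  show "(\<lambda>n. Vbar / (c * real n)) \<in> O(\<lambda>n. 1 / real n)"
    by (rule bigoI[of _ "\<bar>Vbar / c\<bar>"]) (simp add: abs_mult)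
qed

end
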